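(* For $N \in \mathbb{N}$ let $Q_N$ be the set of the first $N$ points of the two-dimensional Sobol' sequence. For every integer $N \ge 2$, \[ q_\infty(Q_N) \le C_1 N^{-3/4}, \qquad \rho_\infty(Q_N) \ge C_2 N^{1/4}, \] where $C_1 = C_2 = 2^{-1/2}$. Moreover, for every integer $N \ge 64$, the same two inequalities hold with the improved constants $C_1 = 2^{-3/4}$ and $C_2 = 2^{-1/4}$.
   Context: $\mathbb{N}$ is the set of positive integers, $\mathbb{N}_0 = \mathbb{N} \cup \{0\}$, and $\mathbb{F}_2$ is the field with two elements. For a finite set $Q \subset [0,1]^2$ with at least two points, the $\ell^\infty$-covering radius, the $\ell^\infty$-separation radius and the $\ell^\infty$-mesh ratio are \[ h_\infty(Q) := \sup_{x \in [0,1]^2} \min_{y \in Q} \|x-y\|_\infty, \quad q_\infty(Q) := \tfrac12 \min_{x,y \in Q,\, x \ne y} \|x-y\|_\infty, \quad \rho_\infty(Q) := \frac{h_\infty(Q)}{q_\infty(Q)}. \] For $m \in \mathbb{N}$ and an integer $0 \le n < 2^m$ with binary expansion $n = n_1 + 2n_2 + \cdots + 2^{m-1} n_m$, $n_i \in \{0,1\}$, put $\vec{n} = (n_1,\dots,n_m)^\top \in \mathbb{F}_2^m$. For $\vec{z} = (z_1,\dots,z_m)^\top \in \mathbb{F}_2^m$, identify each $z_i$ with an element of $\{0,1\}$ and put $\phi(\vec{z}) = \sum_{i=1}^m z_i 2^{-i} \in [0,1)$. The Pascal matrix $P_m \in \mathbb{F}_2^{m\times m}$ has $(i,j)$ entry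 $\binom{j-1}{i-1} \bmod 2$ for $1 \le i,j \le m$. The two-dimensional Sobol' sequence $(\boldsymbol{x}_n)_{n \in \mathbb{N}_0}$ in $[0,1)^2$ is defined by $\boldsymbol{x}_n := (\phi(\vec{n}), \phi(P_m \vec{n}))$, where $m \in \mathbb{N}$ is any integer with $n < 2^m$ (the value does not depend on the choice of $m$), the product $P_m\vec n$ being taken over $\mathbb{F}_2$. The set of the first $N$ points is $Q_N = \{\boldsymbol{x}_0, \dots, \boldsymbol{x}_{N-1}\}$. *)

theory Defs
  imports
    "HOL-Analysis.Linear_Algebra"
    "HOL-Library.Z2"
    "Jordan_Normal_Form.Matrix"
begin

text \<open>On \<^typ>\<open>real \<times> real\<close> the library's \<^const>\<open>infnorm\<close> is the maximum norm; see
  \<open>infnorm_prod\<close> below. All radii are meant for finite sets with at least two points.\<close>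

definition covering_radius :: "(real \<times> real) set \<Rightarrow> real" where
  "covering_radius Q = (SUP x \<in> {0..1} \<times> {0..1}. Min ((\<lambda>y. infnorm (x - y)) ` Q))"

definition separation_radius :: "(real \<times> real) set \<Rightarrow> real" where
  "separation_radius Q = 1/2 * Min {infnorm (x - y) | x y. x \<in> Q \<and> y \<in> Q \<and> x \<noteq> y}"

definition mesh_ratio :: "(real \<times> real) set \<Rightarrow> real" where
  "mesh_ratio Q = covering_radius Q / separation_radius Q"

text \<open>The type \<^typ>\<open>bit\<close> is the two-element field. Vectors and matrices are indexed from 0
  here, so component \<open>i\<close> below is the component usually numbered \<open>i + 1\<close>; this shifts the
  exponent in \<open>radical\<close> and the binomial coefficient in \<open>pascal_mat\<close>.\<close>

definition digit_vec :: "nat \<Rightarrow> nat \<Rightarrow> bit vec" where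
  "digit_vec m n = vec m (\<lambda>i. of_nat (n div 2 ^ i mod 2))"

definition radical :: "bit vec \<Rightarrow> real" where
  "radical z = (\<Sum>i<dim_vec z. (if z $ i = 1 then 1 else 0) / 2 ^ Suc i)"

definition pascal_mat :: "nat \<Rightarrow> bit mat" where
  "pascal_mat m = mat m m (\<lambda>(i, j). of_nat (j choose i))"

definition sobol_digits :: "nat \<Rightarrow> nat \<Rightarrow> real \<times> real" where
  "sobol_digits m n = (radical (digit_vec m n), radical (pascal_mat m *\<^sub>v digit_vec m n))"

text \<open>Any admissible number of digits \<open>m\<close> gives the same point; see \<open>sobol_eq\<close> below.\<close>

definition sobol :: "nat \<Rightarrow> real \<times> real" where
  "sobol n = sobol_digits (LEAST m. 1 \<le> m \<and> n < 2 ^ m) n"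

definition sobol_points :: "nat \<Rightarrow> (real \<times> real) set" where
  "sobol_points N = sobol ` {..<N}"

lemma infnorm_prod: "infnorm (x :: real \<times> real) = max \<bar>fst x\<bar> \<bar>snd x\<bar>"
proof -
  have B: "(Basis :: (real \<times> real) set) = {(1, 0), (0, 1)}"
    by (auto simp: Basis_prod_def)
  have "{\<bar>x \<bullet> b\<bar> | b. b \<in> Basis} = {\<bar>fst x\<bar>, \<bar>snd x\<bar>}"
    unfolding Setcompr_eq_image B by (simp add: inner_prod_def)
  then show ?thesis
    by (simp add: infnorm_def sup_real_def cSup_eq_Max)
qed

lemma sobol_digits_le:
  assumes "n < 2 ^ m" "m \<le> k"
  shows "sobol_digits k n = sobol_digits m n"
proof -
  have zero: "n div 2 ^ j = 0" if "m \<le> j" for j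
    using assms(1) that by (meson div_less less_le_trans one_le_numeral power_increasing)
  have ext: "sum f {..<k} = sum f {..<m}" if "\<And>i. m \<le> i \<Longrightarrow> i < k \<Longrightarrow> f i = 0" for f :: "nat \<Rightarrow> 'a::comm_monoid_add"
    by (rule sum.mono_neutral_right) (use assms(2) that in auto)
  define c where "c i = (\<Sum>j<m. of_nat (j choose i) * (of_nat (n div 2 ^ j mod 2) :: bit))" for i
  have P: "(pascal_mat l *\<^sub>v digit_vec l n) $ i = c i" if "l = m \<or> l = k" "i < l" for l i
  proof -
    have "(pascal_mat l *\<^sub>v digit_vec l n) $ i
        = (\<Sum>j<l. of_nat (j choose i) * (of_nat (n div 2 ^ j mod 2) :: bit))"
      using that(2) by (simp add: pascal_mat_def digit_vec_def scalar_prod_def lessThan_atLeast0)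
    also have "\<dots> = c i"
      using that(1) ext[of "\<lambda>j. of_nat (j choose i) * (of_nat (n div 2 ^ j mod 2) :: bit)"]
      by (auto simp: c_def zero)
    finally show ?thesis .
  qed
  have c0: "c i = 0" if "m \<le> i" for i
    unfolding c_def by (rule sum.neutral) (use that in \<open>auto simp: binomial_eq_0\<close>)
  have d: "dim_vec (pascal_mat l *\<^sub>v digit_vec l n) = l" "dim_vec (digit_vec l n) = l" for l
    by (simp_all add: pascal_mat_def digit_vec_def)
  have D: "digit_vec l n $ i = of_nat (n div 2 ^ i mod 2)" if "i < l" for l i
    using that by (simp add: digit_vec_def)
  have "radical (digit_vec k n) = (\<Sum>i<k. (if (of_nat (n div 2 ^ i mod 2) :: bit) = 1 then 1 else 0) / 2 ^ Suc i)"
    unfolding radical_def d by (rule sum.cong) (simp_all add: D)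
  also have "\<dots> = (\<Sum>i<m. (if (of_nat (n div 2 ^ i mod 2) :: bit) = 1 then 1 else 0) / 2 ^ Suc i)"
    by (rule ext) (simp add: zero)
  also have "\<dots> = radical (digit_vec m n)"
    unfolding radical_def d by (rule sum.cong) (simp_all add: D)
  finally have 1: "radical (digit_vec k n) = radical (digit_vec m n)" .
  have "radical (pascal_mat k *\<^sub>v digit_vec k n) = (\<Sum>i<k. (if c i = 1 then 1 else 0) / 2 ^ Suc i)"
    unfolding radical_def d by (rule sum.cong) (simp_all add: P)
  also have "\<dots> = (\<Sum>i<m. (if c i = 1 then 1 else 0) / 2 ^ Suc i)"
    by (rule ext) (simp add: c0)
  also have "\<dots> = radical (pascal_mat m *\<^sub>v digit_vec m n)"
    unfolding radical_def d by (rule sum.cong) (simp_all add: P)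
  finally show ?thesis
    using 1 by (simp add: sobol_digits_def)
qed

lemma sobol_eq:
  assumes "1 \<le> m" "n < 2 ^ m"
  shows "sobol n = sobol_digits m n"
proof -
  let ?l = "LEAST m. 1 \<le> m \<and> n < 2 ^ m"
  have "1 \<le> ?l \<and> n < 2 ^ ?l" by (rule LeastI[of _ m]) (use assms in simp)
  moreover have "?l \<le> m" by (rule Least_le) (use assms in simp)
  ultimately show ?thesis
    using sobol_digits_le[of n ?l m] by (simp add: sobol_def)
qed

end

theory Submission
  imports
    Defs
    "HOL-Analysis.Henstock_Kurzweil_Integration"
    "HOL-Computational_Algebra.Polynomial"
begin

text \<open>Read the binary digits of \<open>n\<close> as the coefficients of a polynomial over \<open>GF(2)\<close>; the Pascal
  matrix then acts as the substitution \<open>X \<mapsto> X + 1\<close>. Let \<open>a = 2\<^sup>k\<close> and \<open>c = 2\<^sup>l\<close>. By the Frobenius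
  identity \<open>(1 + X)\<^sup>a = 1 + X\<^sup>a\<close>, the polynomials \<open>X\<^bsup>a - 1\<^esup> (1 + X)\<^sup>c\<close> and \<open>X\<^sup>a (1 + X)\<^bsup>c - 1\<^esup>\<close>
  have digit patterns \<open>0\<dots>010\<dots>01\<close> and \<open>0\<dots>001\<dots>11\<close>, a carry apart, and the substitution swaps the
  two families. So the two points differ by \<open>2\<^bsup>-(a + c - 1)\<^esup>\<close> in both coordinates, although their
  indices are below \<open>2\<^bsup>a + c\<^esup>\<close>; for \<open>a = c\<close> a variant has indices below \<open>2\<^bsup>2a - 1\<^esup>\<close>. The exponents
  \<open>a + c\<close> equal to 4, 5, 6, 8 times a power of two suffice for large \<open>N\<close>: the largest gap, from
  6 to 8, has ratio \<open>4/3\<close> and produces the exponent \<open>3/4\<close>. Finitely many small \<open>N\<close> are covered by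
  explicit pairs, so the improved constants hold for all \<open>N \<ge> 2\<close>. The bound on the mesh ratio
  follows from \<open>4 N h\<^sup>2 \<ge> 1\<close>, obtained by comparing areas.\<close>

section \<open>Powers of \<open>1 + X\<close> over the two-element field\<close>

lemma two_eq_zero_bit_poly: "(2 :: bit poly) = 0"
  by (simp add: poly_eq_iff numeral_poly)

lemma add_self_bit_poly: "p + p = 0" for p :: "bit poly"
  by (metis mult_2 mult_zero_left two_eq_zero_bit_poly)

lemma uminus_bit_poly: "- p = p" for p :: "bit poly"
  using add_self_bit_poly[of p] by (simp add: add_eq_0_iff)

text \<open>Squaring is additive in characteristic 2, as the cross term occurs twice and
  cancels.\<close>

lemma one_plus_X_power_two_power: "[:1, 1 :: bit:] ^ 2 ^ k = 1 + monom 1 (2 ^ k)"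
proof (induction k)
  case 0
  then show ?case by (simp add: monom_Suc monom_0 one_pCons)
next
  case (Suc k)
  have "[:1, 1 :: bit:] ^ 2 ^ Suc k = (1 + monom 1 (2 ^ k))\<^sup>2"
    by (simp add: Suc power_mult mult.commute[of 2])
  also have "\<dots> = 1 + (monom 1 (2 ^ k) + monom 1 (2 ^ k)) + monom 1 (2 ^ k + 2 ^ k)"
    by (simp add: power2_eq_square algebra_simps mult_monom)
  also have "\<dots> = 1 + monom 1 (2 ^ Suc k)"
    by (simp only: add_self_bit_poly) (simp add: mult_2)
  finally show ?case .
qed

lemma one_plus_X_mult_sum: "[:1, 1 :: bit:] * (\<Sum>i<n. monom 1 i) = 1 + monom 1 n"
proof -
  have X: "1 - monom 1 1 = [:1, 1 :: bit:]"
    by (simp add: diff_conv_add_uminus uminus_bit_poly monom_Suc monom_0 one_pCons del: add_uminus_conv_diff)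
  show ?thesis
    using one_diff_power_eq[of "monom (1 :: bit) 1" n]
    unfolding X monom_power by (simp add: diff_conv_add_uminus uminus_bit_poly del: add_uminus_conv_diff)
qed

text \<open>Multiplied by \<open>1 + X\<close>, both sides become \<open>1 + X^(2^k)\<close>: one by
  Frobenius, the other by the geometric sum. The factor can be cancelled in a domain.\<close>

lemma one_plus_X_power_two_power_minus_1:
  "[:1, 1 :: bit:] ^ (2 ^ k - 1) = (\<Sum>i<2 ^ k. monom 1 i)"
proof -
  have "[:1, 1 :: bit:] * [:1, 1:] ^ (2 ^ k - 1) = [:1, 1:] * (\<Sum>i<2 ^ k. monom 1 i)"
    unfolding one_plus_X_mult_sum one_plus_X_power_two_power[symmetric]
    by (subst (3) power_eq_if) simp
  then show ?thesis
    by (simp only: mult_cancel_left) simp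
qed

lemma coeff_one_plus_X_power_two_power_minus_1:
  "coeff ([:1, 1 :: bit:] ^ (2 ^ k - 1)) i = of_bool (i < 2 ^ k)"
  unfolding one_plus_X_power_two_power_minus_1 coeff_sum by (simp add: if_distrib sum.delta)

lemma coeff_one_plus_X_power: "coeff ([:1, 1 :: bit:] ^ n) i = of_nat (n choose i)"
proof (cases "i \<le> n")
  case False
  then have "degree ([:1, 1 :: bit:] ^ n) < i"
    using degree_power_le[of "[:1, 1 :: bit:]" n] by simp
  with False show ?thesis
    by (simp add: coeff_eq_0 binomial_eq_0)
qed (simp add: coeff_linear_poly_power)

section \<open>The substitution of \<open>X + 1\<close> for \<open>X\<close>, and Sobol' points
  given by polynomials\<close>

lemma pcompose_power: "(p ^ n) \<circ>\<^sub>p q = (p \<circ>\<^sub>p q) ^ n" for p q :: "'a::comm_ring_1 poly"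
  by (induction n) (simp_all add: pcompose_1 pcompose_mult)

lemma pcompose_monom_one: "monom 1 n \<circ>\<^sub>p q = q ^ n" for q :: "'a::comm_ring_1 poly"
  using pcompose_power[of "monom 1 1" n q]
  by (simp add: monom_power) (simp add: monom_Suc monom_0 pcompose_pCons)

text \<open>The substitution is an involution: it sends \<open>X\<close> to \<open>1 + X\<close> and
  \<open>1 + X\<close> back to \<open>X\<close>.\<close>

lemma pcompose_one_plus_X: "[:1, 1 :: bit:] \<circ>\<^sub>p [:1, 1:] = monom 1 1"
  by (simp add: pcompose_pCons monom_Suc monom_0)

text \<open>The map phi on the first \<open>m\<close> coefficients; the constant coefficient is the
  leading binary digit.\<close>

definition digits_value :: "nat \<Rightarrow> bit poly \<Rightarrow> real" where
  "digits_value m p = (\<Sum>i<m. of_bool (coeff p i = 1) / 2 ^ Suc i)"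

lemma digits_value_eq_sum:
  assumes "\<And>i. i < m \<Longrightarrow> coeff p i = 1 \<longleftrightarrow> i \<in> S" "S \<subseteq> {..<m}"
  shows "digits_value m p = (\<Sum>i\<in>S. 1 / 2 ^ Suc i)"
proof -
  have "digits_value m p = (\<Sum>i<m. if i \<in> S then 1 / 2 ^ Suc i else 0)"
    unfolding digits_value_def by (rule sum.cong) (use assms(1) in auto)
  also have "\<dots> = (\<Sum>i\<in>{..<m} \<inter> S. 1 / 2 ^ Suc i)"
    by (simp only: sum.inter_restrict finite_lessThan)
  finally show ?thesis
    using assms(2) by (simp add: Int_absorb1)
qed

lemma sum_inverse_powers_two:
  "a \<le> b \<Longrightarrow> (\<Sum>i\<in>{a..<b}. 1 / 2 ^ Suc i) = 1 / 2 ^ a - 1 / (2 ^ b :: real)"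
proof (induction b rule: dec_induct)
  case (step n)
  have "1 / 2 ^ n = 2 * (1 / 2 ^ Suc n :: real)"
    by simp
  with step show ?case
    by (simp del: power_Suc)
qed simp

lemma radical_vec_coeff: "Defs.radical (Matrix.vec m (coeff p)) = digits_value m p"
  unfolding radical_def digits_value_def by (simp add: of_bool_def)

text \<open>Column \<open>j\<close> of the Pascal matrix lists the coefficients of
  \<open>(1 + X)^j\<close>, the image of \<open>X^j\<close>; linearity does the rest.\<close>

lemma pascal_mat_mult_vec_coeff:
  assumes "\<And>i. m \<le> i \<Longrightarrow> coeff p i = 0"
  shows "pascal_mat m *\<^sub>v Matrix.vec m (coeff p) = Matrix.vec m (coeff (p \<circ>\<^sub>p [:1, 1:]))"
proof (rule eq_vecI)
  fix i assume "i < dim_vec (Matrix.vec m (coeff (p \<circ>\<^sub>p [:1, 1:])))"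
  then have i: "i < m" by simp
  then have "degree p \<le> m - 1"
    using assms by (intro degree_le) auto
  then have "p = (\<Sum>j<m. monom (coeff p j) j)"
    using poly_as_sum_of_monoms'[of p "m - 1"] i by (metis Suc_pred' less_nat_zero_code lessThan_Suc_atMost not_gr_zero)
  also have "\<dots> = (\<Sum>j<m. smult (coeff p j) (monom 1 j))"
    by (simp only: smult_monom mult_1_right)
  finally have "p \<circ>\<^sub>p [:1, 1:] = (\<Sum>j<m. smult (coeff p j) ([:1, 1:] ^ j))"
    by (metis (no_types, lifting) pcompose_sum pcompose_smult pcompose_monom_one sum.cong)
  then have "coeff (p \<circ>\<^sub>p [:1, 1:]) i = (\<Sum>j<m. of_nat (j choose i) * coeff p j)"
    by (simp only: coeff_sum coeff_smult coeff_one_plus_X_power mult.commute)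
  with i show "(pascal_mat m *\<^sub>v Matrix.vec m (coeff p)) $ i = Matrix.vec m (coeff (p \<circ>\<^sub>p [:1, 1:])) $ i"
    by (simp add: pascal_mat_def scalar_prod_def lessThan_atLeast0)
qed (simp add: pascal_mat_def)

text \<open>Allows a point to be prescribed by a polynomial; of its index only the bound
  \<open>2 ^ m\<close> is kept, to be compared with the number of points.\<close>

lemma ex_sobol_eq_digits_values:
  assumes "1 \<le> m" "\<And>i. m \<le> i \<Longrightarrow> coeff p i = 0"
  shows "\<exists>n<2 ^ m. sobol n = (digits_value m p, digits_value m (p \<circ>\<^sub>p [:1, 1:]))"
proof -
  \<comment> \<open>The index whose binary digit at position \<open>i\<close> is the coefficient of
    \<open>X^i\<close>.\<close>
  define n :: nat where "n = horner_sum of_bool 2 (map (\<lambda>i. coeff p i = 1) [0..<m])"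
  have bit: "bit n i \<longleftrightarrow> coeff p i = 1" if "i < m" for i
    using that by (simp add: n_def bit_horner_sum_bit_iff)
  have "n = take_bit m n"
    by (simp add: n_def take_bit_horner_sum_bit_eq)
  then have n: "n < 2 ^ m"
    by (metis take_bit_nat_less_exp)
  have "digit_vec m n = Matrix.vec m (coeff p)"
  proof (rule eq_vecI)
    fix i assume "i < dim_vec (Matrix.vec m (coeff p))"
    then show "digit_vec m n $ i = Matrix.vec m (coeff p) $ i"
      using bit[of i] by (cases "coeff p i") (simp_all add: digit_vec_def bit_iff_odd odd_iff_mod_2_eq_one)
  qed (simp add: digit_vec_def)
  with n assms show ?thesis
    by (intro exI[of _ n])
      (simp add: sobol_eq[of m] sobol_digits_def pascal_mat_mult_vec_coeff radical_vec_coeff)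
qed


section \<open>Families of close pairs\<close>

definition has_close_pair :: "nat \<Rightarrow> nat \<Rightarrow> bool" where
  "has_close_pair N M \<longleftrightarrow>
    (\<exists>x\<in>sobol_points N. \<exists>y\<in>sobol_points N. x \<noteq> y \<and> infnorm (x - y) \<le> 1 / 2 ^ M)"

text \<open>Equality in the first coordinate makes the two points distinct as well as close.\<close>

lemma has_close_pairI:
  assumes "1 \<le> m" "2 ^ m \<le> N"
    and "\<And>i. m \<le> i \<Longrightarrow> coeff p i = 0" "\<And>i. m \<le> i \<Longrightarrow> coeff q i = 0"
    and fst: "\<bar>digits_value m p - digits_value m q\<bar> = 1 / 2 ^ M"
    and snd: "\<bar>digits_value m (p \<circ>\<^sub>p [:1, 1:]) - digits_value m (q \<circ>\<^sub>p [:1, 1:])\<bar> \<le> 1 / 2 ^ M"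
  shows "has_close_pair N M"
proof -
  obtain n where n: "n < 2 ^ m" "sobol n = (digits_value m p, digits_value m (p \<circ>\<^sub>p [:1, 1:]))"
    using ex_sobol_eq_digits_values[of m p] assms by auto
  obtain k where k: "k < 2 ^ m" "sobol k = (digits_value m q, digits_value m (q \<circ>\<^sub>p [:1, 1:]))"
    using ex_sobol_eq_digits_values[of m q] assms by auto
  have "sobol n \<noteq> sobol k"
    using fst by (auto simp: n k)
  moreover have "infnorm (sobol n - sobol k) \<le> 1 / 2 ^ M"
    using fst snd by (simp add: infnorm_prod n k)
  moreover have "sobol n \<in> sobol_points N" "sobol k \<in> sobol_points N"
    unfolding sobol_points_def using n(1) k(1) assms(2) by (auto intro!: imageI)
  ultimately show ?thesis
    unfolding has_close_pair_def by blast
qed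

text \<open>By Frobenius only the two extreme terms survive.\<close>

lemma coeff_monom_mult_one_plus_X_power:
  assumes "0 < a"
  shows "coeff (monom 1 (a - 1) * [:1, 1 :: bit:] ^ 2 ^ l) i = of_bool (i = a - 1 \<or> i = a + 2 ^ l - 1)"
  using assms by (auto simp: one_plus_X_power_two_power coeff_monom_mult)

lemma coeff_monom_mult_one_plus_X_power_minus_1:
  "coeff (monom 1 a * [:1, 1 :: bit:] ^ (2 ^ l - 1)) i = of_bool (a \<le> i \<and> i < a + 2 ^ l)"
  by (auto simp: coeff_one_plus_X_power_two_power_minus_1 coeff_monom_mult simp del: One_nat_def)

lemma digits_value_monom_mult_one_plus_X_power:
  assumes "0 < a"
  shows "digits_value (a + 2 ^ l) (monom 1 (a - 1) * [:1, 1:] ^ 2 ^ l)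
    = 1 / 2 ^ a + 1 / 2 ^ (a + 2 ^ l)"
proof -
  have "digits_value (a + 2 ^ l) (monom 1 (a - 1) * [:1, 1:] ^ 2 ^ l)
      = (\<Sum>i\<in>{a - 1, a + 2 ^ l - 1}. 1 / 2 ^ Suc i)"
    by (rule digits_value_eq_sum)
      (use assms in \<open>auto simp: coeff_monom_mult_one_plus_X_power simp del: One_nat_def\<close>)
  moreover have "a - 1 \<noteq> a + 2 ^ l - 1"
    using assms zero_less_power[of "2 :: nat" l] by linarith
  then have "(\<Sum>i\<in>{a - 1, a + 2 ^ l - 1}. 1 / 2 ^ Suc i)
      = 1 / 2 ^ Suc (a - 1) + (1 / 2 ^ Suc (a + 2 ^ l - 1) :: real)"
    by (simp only: sum.insert sum.empty finite.emptyI finite_insert insert_iff empty_iff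
        add_0_right simp_thms)
  moreover have "Suc (a - 1) = a" "Suc (a + 2 ^ l - 1) = a + 2 ^ l"
    using assms by (intro Suc_diff_1; simp)+
  ultimately show ?thesis
    by (simp only:)
qed

lemma digits_value_monom_mult_one_plus_X_power_minus_1:
  "digits_value (a + 2 ^ l) (monom 1 a * [:1, 1:] ^ (2 ^ l - 1)) = 1 / 2 ^ a - 1 / 2 ^ (a + 2 ^ l)"
proof -
  have "digits_value (a + 2 ^ l) (monom 1 a * [:1, 1:] ^ (2 ^ l - 1))
      = (\<Sum>i\<in>{a..<a + 2 ^ l}. 1 / 2 ^ Suc i)"
    by (rule digits_value_eq_sum) (auto simp: coeff_monom_mult_one_plus_X_power_minus_1 simp del: One_nat_def)
  then show ?thesis
    by (simp only: sum_inverse_powers_two le_add1)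
qed

text \<open>With \<open>a = 2 ^ k\<close> and \<open>c = 2 ^ l\<close>, the first coordinates are
  \<open>2^(-a)\<close> plus and minus \<open>2^(-(a + c))\<close>, and the second ones are
  \<open>2^(-c)\<close> minus and plus the same amount.\<close>

lemma has_close_pair_two_powers:
  assumes "2 ^ (2 ^ k + 2 ^ l) \<le> N"
  shows "has_close_pair N (2 ^ k + 2 ^ l - 1)"
proof (rule has_close_pairI)
  let ?a = "2 ^ k :: nat" and ?c = "2 ^ l :: nat"
  let ?Z = "[:1, 1 :: bit:]"
  let ?p = "monom 1 (?a - 1) * ?Z ^ ?c" and ?q = "monom 1 ?a * ?Z ^ (?c - 1)"
  show "1 \<le> ?a + ?c" "2 ^ (?a + ?c) \<le> N"
    using assms by (simp_all add: Suc_le_eq)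
  show "coeff ?p i = 0" if "?a + ?c \<le> i" for i
  proof -
    have "0 < ?a" "0 < ?c" by simp_all
    with that have "i \<noteq> ?a - 1" "i \<noteq> ?a + ?c - 1" by linarith+
    then show ?thesis
      by (simp add: coeff_monom_mult_one_plus_X_power del: One_nat_def)
  qed
  show "coeff ?q i = 0" if "?a + ?c \<le> i" for i
    using that by (simp add: coeff_monom_mult_one_plus_X_power_minus_1 del: One_nat_def)
  have "Suc (?a + ?c - 1) = ?a + ?c"
    by (simp add: Suc_diff_1)
  then have "2 ^ (?a + ?c) = 2 * (2 ^ (?a + ?c - 1) :: real)"
    by (metis power_Suc)
  then have M: "1 / 2 ^ (?a + ?c - 1) = 2 * (1 / 2 ^ (?a + ?c) :: real)"
    by (simp del: One_nat_def)
  \<comment> \<open>Swapping \<open>X\<close> and \<open>1 + X\<close> turns each pattern into the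
    other one with \<open>a\<close> and \<open>c\<close> exchanged, so the same two value lemmas
    apply again.\<close>
  have p: "?p \<circ>\<^sub>p ?Z = monom 1 ?c * ?Z ^ (?a - 1)"
    by (simp only: pcompose_mult pcompose_power pcompose_monom_one pcompose_one_plus_X
        monom_power mult_1 power_one mult.commute)
  have q: "?q \<circ>\<^sub>p ?Z = monom 1 (?c - 1) * ?Z ^ ?a"
    by (simp only: pcompose_mult pcompose_power pcompose_monom_one pcompose_one_plus_X
        monom_power mult_1 power_one mult.commute)
  have pos: "0 < ?a" "0 < ?c" by simp_all
  show "\<bar>digits_value (?a + ?c) ?p - digits_value (?a + ?c) ?q\<bar> = 1 / 2 ^ (?a + ?c - 1)"
    unfolding digits_value_monom_mult_one_plus_X_power[OF pos(1)]
      digits_value_monom_mult_one_plus_X_power_minus_1 M by simp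
  have vp: "digits_value (?a + ?c) (?p \<circ>\<^sub>p ?Z) = 1 / 2 ^ ?c - 1 / 2 ^ (?a + ?c)"
    using digits_value_monom_mult_one_plus_X_power_minus_1[of ?c k] by (simp only: p add.commute)
  have vq: "digits_value (?a + ?c) (?q \<circ>\<^sub>p ?Z) = 1 / 2 ^ ?c + 1 / 2 ^ (?a + ?c)"
    using digits_value_monom_mult_one_plus_X_power[OF pos(2), of k] by (simp only: q add.commute)
  show "\<bar>digits_value (?a + ?c) (?p \<circ>\<^sub>p ?Z) - digits_value (?a + ?c) (?q \<circ>\<^sub>p ?Z)\<bar> \<le> 1 / 2 ^ (?a + ?c - 1)"
    unfolding vp vq M by simp
qed

text \<open>The distance is that of \<open>has_close_pair_two_powers\<close> for equal powers, but
  one binary digit fewer is used. The term \<open>X^(a - 1) (1 + X)^(a - 1)\<close> is fixed by the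
  substitution.\<close>

lemma has_close_pair_two_power:
  assumes "2 ^ (2 * 2 ^ k - 1) \<le> N"
  shows "has_close_pair N (2 * 2 ^ k - 1)"
proof (rule has_close_pairI)
  define a where "a = (2 ^ k :: nat)"
  define m where "m = 2 * a - 1"
  have a: "0 < a" by (simp add: a_def)
  let ?Z = "[:1, 1 :: bit:]"
  let ?p = "monom 1 (a - 1) :: bit poly"
  \<comment> \<open>The added product is a block of ones at positions \<open>a - 1\<close> to
    \<open>2 * a - 2\<close>; its lowest one cancels against \<open>?p\<close>, which leaves the
    digits just below a carry.\<close>
  let ?q = "?p + ?p * ?Z ^ (a - 1)"
  have m: "2 * 2 ^ k - 1 = m" by (simp add: m_def a_def)
  have Z: "coeff (?Z ^ (a - 1)) i = of_bool (i < a)" for i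
    unfolding a_def by (rule coeff_one_plus_X_power_two_power_minus_1)
  have pZ: "coeff (?p * ?Z ^ (a - 1)) i = of_bool (a - 1 \<le> i \<and> i < m)" for i
    unfolding a_def coeff_monom_mult_one_plus_X_power_minus_1 using a by (auto simp: a_def m_def)
  have q: "coeff ?q i = of_bool (a \<le> i \<and> i < m)" for i
    unfolding coeff_add pZ using a by (auto simp: m_def)
  have p_comp: "?p \<circ>\<^sub>p ?Z = ?Z ^ (a - 1)"
    by (simp only: pcompose_monom_one)
  have q_comp: "?q \<circ>\<^sub>p ?Z = ?Z ^ (a - 1) + ?p * ?Z ^ (a - 1)"
    by (simp only: pcompose_add pcompose_mult pcompose_power pcompose_monom_one pcompose_one_plus_X
        monom_power mult_1 power_one mult.commute)
  have coeff_q_comp: "coeff (?q \<circ>\<^sub>p ?Z) i = of_bool (i < m \<and> i \<noteq> a - 1)" for i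
    unfolding q_comp coeff_add pZ Z using a by (auto simp: m_def)
  show "1 \<le> m" "2 ^ m \<le> N"
    using assms a m by (auto simp: m_def)
  show "coeff ?p i = 0" if "m \<le> i" for i
    using that a by (auto simp: m_def)
  show "coeff ?q i = 0" if "m \<le> i" for i
    using that unfolding q by simp
  have vp: "digits_value m ?p = 1 / 2 ^ a"
  proof -
    have "digits_value m ?p = (\<Sum>i\<in>{a - 1}. 1 / 2 ^ Suc i)"
      by (rule digits_value_eq_sum) (use a in \<open>auto simp: m_def\<close>)
    then show ?thesis using a by (simp del: power_Suc)
  qed
  have vq: "digits_value m ?q = 1 / 2 ^ a - 1 / 2 ^ m"
  proof -
    have "digits_value m ?q = (\<Sum>i\<in>{a..<m}. 1 / 2 ^ Suc i)"
      by (rule digits_value_eq_sum) (unfold q, auto)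
    moreover have "a \<le> m"
      using a by (simp add: m_def)
    ultimately show ?thesis
      by (simp only: sum_inverse_powers_two)
  qed
  have vpc: "digits_value m (?p \<circ>\<^sub>p ?Z) = 1 - 1 / 2 ^ a"
  proof -
    have "digits_value m (?p \<circ>\<^sub>p ?Z) = (\<Sum>i\<in>{0..<a}. 1 / 2 ^ Suc i)"
      by (rule digits_value_eq_sum) (use a in \<open>auto simp: p_comp Z m_def simp del: One_nat_def\<close>)
    then show ?thesis
      by (simp only: sum_inverse_powers_two le0) simp
  qed
  have vqc: "digits_value m (?q \<circ>\<^sub>p ?Z) = 1 - 1 / 2 ^ m - 1 / 2 ^ a"
  proof -
    \<comment> \<open>The sum cancels the digit at \<open>a - 1\<close>, where both summands are 1;
      this digit is worth \<open>1 / 2 ^ a\<close>.\<close>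
    have "digits_value m (?q \<circ>\<^sub>p ?Z) = (\<Sum>i\<in>{0..<m} - {a - 1}. 1 / 2 ^ Suc i)"
      by (rule digits_value_eq_sum) (unfold coeff_q_comp, auto)
    also have "\<dots> = (\<Sum>i\<in>{0..<m}. 1 / 2 ^ Suc i) - 1 / 2 ^ Suc (a - 1)"
      by (subst sum_diff1) (use a in \<open>auto simp: m_def\<close>)
    finally show ?thesis
      using a by (simp only: sum_inverse_powers_two le0 Suc_diff_1) simp
  qed
  show "\<bar>digits_value m ?p - digits_value m ?q\<bar> = 1 / 2 ^ (2 * 2 ^ k - 1)"
    unfolding m vp vq by simp
  show "\<bar>digits_value m (?p \<circ>\<^sub>p ?Z) - digits_value m (?q \<circ>\<^sub>p ?Z)\<bar> \<le> 1 / 2 ^ (2 * 2 ^ k - 1)"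
    unfolding m vpc vqc by simp
qed


section \<open>Explicit pairs for small \<open>N\<close>\<close>

lemma sum_lessThan_numeral:
  "(\<Sum>i<numeral k. f i) = (\<Sum>i<pred_numeral k. f i) + f (pred_numeral k)"
  by (simp add: numeral_eq_Suc)

lemma binomial_numeral:
  "numeral n choose numeral k = (pred_numeral n choose pred_numeral k) + (pred_numeral n choose numeral k)"
  by (simp add: numeral_eq_Suc)

lemma sobol_1: "sobol 1 = (1/2, 1/2)"
  by (subst sobol_eq[of 1])
    (simp_all add: sobol_digits_def Defs.radical_def digit_vec_def pascal_mat_def scalar_prod_def)

lemma sobol_values:
  "sobol 2 = (1/4, 3/4)" "sobol 9 = (9/16, 7/16)"
  "sobol 40 = (5/64, 15/64)" "sobol 48 = (3/64, 17/64)"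
  by (simp_all add: sobol_eq[of 2 2] sobol_eq[of 4 9] sobol_eq[of 6 40] sobol_eq[of 6 48]
      sobol_digits_def Defs.radical_def digit_vec_def pascal_mat_def scalar_prod_def
      lessThan_atLeast0[symmetric] sum_lessThan_numeral binomial_numeral binomial_eq_0)

text \<open>Fills gaps left by the two families. Each threshold is one more than the larger index of
  the pair, since \<open>N\<close> points have indices below \<open>N\<close>.\<close>

lemma has_close_pair_small:
  "3 \<le> N \<Longrightarrow> has_close_pair N 2" "10 \<le> N \<Longrightarrow> has_close_pair N 4" "49 \<le> N \<Longrightarrow> has_close_pair N 5"
proof -
  have *: "has_close_pair N M"
    if "n < N" "k < N" "sobol n \<noteq> sobol k" "infnorm (sobol n - sobol k) \<le> 1 / 2 ^ M" for n k M
    using that unfolding has_close_pair_def sobol_points_def by blast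
  show "3 \<le> N \<Longrightarrow> has_close_pair N 2"
    by (rule *[of 1 2]) (simp_all add: sobol_1 sobol_values infnorm_prod del: One_nat_def)
  show "10 \<le> N \<Longrightarrow> has_close_pair N 4"
    by (rule *[of 1 9]) (simp_all add: sobol_1 sobol_values infnorm_prod del: One_nat_def)
  show "49 \<le> N \<Longrightarrow> has_close_pair N 5"
    by (rule *[of 40 48]) (simp_all add: sobol_values infnorm_prod)
qed

section \<open>Choice of a close pair for every \<open>N\<close>\<close>

lemma cube_le_two_power:
  fixes N :: nat
  assumes "N \<le> 2 ^ t" "3 * t \<le> e"
  shows "N ^ 3 \<le> 2 ^ e"
proof -
  have "N ^ 3 \<le> (2 ^ t) ^ 3"
    using assms(1) by (rule power_mono) simp
  also have "\<dots> = 2 ^ (3 * t)"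
    by (simp add: power_mult mult.commute)
  also have "\<dots> \<le> 2 ^ e"
    using assms(2) by (intro power_increasing) simp_all
  finally show ?thesis .
qed

text \<open>The inequality on \<open>N ^ 3\<close> is an integer form of
  \<open>2^(-(M + 1)) \<le> (2 N)^(-3/4)\<close>, the wanted bound on half the distance.\<close>

lemma ex_close_pair_large:
  fixes N :: nat
  assumes "2 ^ 15 \<le> N"
  shows "\<exists>M. has_close_pair N M \<and> N ^ 3 \<le> 2 ^ (4 * M + 1)"
proof -
  \<comment> \<open>With \<open>s = 2 ^ j\<close> this locates \<open>N\<close> between
    \<open>2 ^ (4 * s - 1)\<close> and \<open>2 ^ (8 * s - 1)\<close>. The offset 1 is the digit
    saved by the pair for equal powers.\<close>
  define j where "j = (LEAST j. N < 2 ^ (8 * 2 ^ j - 1))"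
  have "N < 2 ^ (8 * 2 ^ N - 1)"
  proof -
    have "N < 2 ^ N" by simp
    also have "2 ^ N < (8 * 2 ^ N - 1 :: nat)"
      using zero_less_power[of "2::nat" N] by linarith
    also have "\<dots> < 2 ^ (8 * 2 ^ N - 1)" by simp
    finally show ?thesis .
  qed
  then have ub: "N < 2 ^ (8 * 2 ^ j - 1)"
    unfolding j_def by (rule LeastI)
  have "\<not> 8 * 2 ^ j - 1 \<le> (15 :: nat)"
  proof
    assume "8 * 2 ^ j - 1 \<le> (15 :: nat)"
    then have "2 ^ (8 * 2 ^ j - 1) \<le> (2 :: nat) ^ 15"
      by (intro power_increasing) simp_all
    with ub assms show False by linarith
  qed
  then have "2 < (2 :: nat) ^ j" by simp
  have j: "1 < j"
  proof (rule ccontr)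
    assume "\<not> 1 < j"
    then have "j = 0 \<or> j = 1" by linarith
    with \<open>2 < 2 ^ j\<close> show False by auto
  qed
  then have "\<not> N < 2 ^ (8 * 2 ^ (j - 1) - 1)"
    unfolding j_def by (intro not_less_Least) simp
  moreover have s4: "8 * 2 ^ (j - 1) = 4 * (2 ^ j :: nat)"
    using j by (cases j) simp_all
  ultimately have lb: "2 ^ (4 * 2 ^ j - 1) \<le> N"
    by (simp only: not_less)
  define s where "s = (2 ^ j :: nat)"
  \<comment> \<open>The first case below requires \<open>15 * s \<le> 16 * s - 3\<close>, hence this
    bound.\<close>
  have s: "3 \<le> s" using \<open>2 < 2 ^ j\<close> by (simp add: s_def)
  \<comment> \<open>The exponents split as \<open>4 * s = 2 * s + 2 * s\<close>,
    \<open>5 * s = s + 4 * s\<close> and \<open>6 * s = 2 * s + 4 * s\<close>.\<close>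
  consider "N < 2 ^ (5 * s)" | "2 ^ (5 * s) \<le> N" "N < 2 ^ (6 * s)" | "2 ^ (6 * s) \<le> N"
    by linarith
  then show ?thesis
  proof cases
    case 1
    have "has_close_pair N (4 * s - 1)"
      using has_close_pair_two_power[of "Suc j" N] lb by (simp add: s_def)
    moreover have "N ^ 3 \<le> 2 ^ (4 * (4 * s - 1) + 1)"
      by (rule cube_le_two_power[of _ "5 * s"]) (use 1 s in linarith)+
    ultimately show ?thesis by blast
  next
    case 2
    have "has_close_pair N (5 * s - 1)"
      using has_close_pair_two_powers[of j "Suc (Suc j)" N] 2 by (simp add: s_def)
    moreover have "N ^ 3 \<le> 2 ^ (4 * (5 * s - 1) + 1)"
      by (rule cube_le_two_power[of _ "6 * s"]) (use 2 s in linarith)+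
    ultimately show ?thesis by blast
  next
    case 3
    have "has_close_pair N (6 * s - 1)"
      using has_close_pair_two_powers[of "Suc j" "Suc (Suc j)" N] 3 by (simp add: s_def)
    \<comment> \<open>Tight: \<open>3 * (8 * s - 1)\<close> equals
      \<open>4 * (6 * s - 1) + 1\<close>, so the saved digit is essential here.\<close>
    moreover have "N ^ 3 \<le> 2 ^ (4 * (6 * s - 1) + 1)"
      by (rule cube_le_two_power[of _ "8 * s - 1"]) (use ub s in \<open>simp_all add: s_def\<close>)
    ultimately show ?thesis by blast
  qed
qed

lemma ex_close_pair:
  fixes N :: nat
  assumes "2 \<le> N"
  shows "\<exists>M. has_close_pair N M \<and> N ^ 3 \<le> 2 ^ (4 * M + 1)"
proof (cases "2 ^ 15 \<le> N")
  case True
  then show ?thesis by (rule ex_close_pair_large)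
next
  case False
  have mid: "\<exists>M. has_close_pair N M \<and> N ^ 3 \<le> 2 ^ (4 * M + 1)"
    if "has_close_pair N M" "N \<le> b" "b ^ 3 \<le> 2 ^ (4 * M + 1)" for M b
    using that(1) order_trans[OF power_mono[OF that(2) zero_le] that(3)] by blast
  \<comment> \<open>Most upper ends are the cube root of \<open>2 ^ (4 * M + 1)\<close> rounded
    down, for the \<open>M\<close> of the case. Only 1024 and 4096 are smaller: there the next pair
    becomes available.\<close>
  consider "N \<le> 3" | "3 < N" "N \<le> 8" | "8 < N" "N \<le> 20" | "20 < N" "N \<le> 50" | "50 < N" "N \<le> 128"
    | "128 < N" "N \<le> 812" | "812 < N" "N \<le> 1024" | "1024 < N" "N \<le> 4096" | "4096 < N" "N \<le> 2 ^ 15"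
    using False by linarith
  then show ?thesis
  proof cases
    case 1 then show ?thesis
      using has_close_pair_two_power[of 0 N] assms by (intro mid[of 1 3]) simp_all
  next
    case 2 then show ?thesis
      using has_close_pair_small by (intro mid[of 2 8]) simp_all
  next
    case 3 then show ?thesis
      using has_close_pair_two_power[of 1 N] by (intro mid[of 3 20]) simp_all
  next
    case 4 then show ?thesis
      using has_close_pair_small by (intro mid[of 4 50]) simp_all
  next
    case 5 then show ?thesis
      using has_close_pair_small by (intro mid[of 5 128]) simp_all
  next
    case 6 then show ?thesis
      using has_close_pair_two_power[of 2 N] by (intro mid[of 7 812]) simp_all
  next
    case 7 then show ?thesis
      using has_close_pair_two_powers[of 0 3 N] by (intro mid[of 8 1024]) simp_all
  next
    case 8 then show ?thesis
      using has_close_pair_two_powers[of 1 3 N] by (intro mid[of 9 4096]) simp_all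
  next
    case 9 then show ?thesis
      using has_close_pair_two_powers[of 2 3 N] by (intro mid[of 11 "2 ^ 15"]) simp_all
  qed
qed

section \<open>Separation and covering radii of finite sets\<close>

lemma
  assumes "finite Q" "x \<in> Q" "y \<in> Q" "x \<noteq> y"
  shows separation_radius_le: "separation_radius Q \<le> infnorm (x - y) / 2"
    and separation_radius_pos: "0 < separation_radius Q"
proof -
  let ?D = "{infnorm (x - y) | x y. x \<in> Q \<and> y \<in> Q \<and> x \<noteq> y}"
  have "?D \<subseteq> (\<Union>x\<in>Q. (\<lambda>y. infnorm (x - y)) ` Q)"
    by blast
  then have fin: "finite ?D"
    by (rule finite_subset) (use assms(1) in simp)
  have mem: "infnorm (x - y) \<in> ?D"
    using assms by blast
  from Min_le[OF fin mem] show "separation_radius Q \<le> infnorm (x - y) / 2"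
    by (simp add: separation_radius_def)
  have "0 < d" if "d \<in> ?D" for d
  proof -
    from that obtain u v :: "real \<times> real" where "u \<noteq> v" "d = infnorm (u - v)"
      by blast
    then show ?thesis
      by (simp only: infnorm_pos_lt right_minus_eq not_False_eq_True)
  qed
  moreover have "Min ?D \<in> ?D"
    using fin mem by (intro Min_in) blast+
  ultimately have "0 < Min ?D" .
  then show "0 < separation_radius Q"
    by (simp add: separation_radius_def)
qed

text \<open>The closed squares of side \<open>2 * h\<close> centred at the points of
  \<open>Q\<close> cover the unit square, so their areas sum to at least 1.\<close>

lemma card_mult_covering_radius_ge:
  assumes "finite Q" "Q \<noteq> {}"
  shows "1 \<le> real (card Q) * (2 * covering_radius Q)\<^sup>2"
    and "0 \<le> covering_radius Q"
proof -
  define h where "h = covering_radius Q"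
  define B where "B y = cbox (fst y - h, snd y - h) (fst y + h, snd y + h)" for y :: "real \<times> real"
  obtain y0 where y0: "y0 \<in> Q"
    using assms(2) by blast
  let ?f = "\<lambda>x. Min ((\<lambda>y. infnorm (x - y)) ` Q)"
  \<comment> \<open>Boundedness is what makes the real supremum an upper bound.\<close>
  have bdd: "bdd_above (?f ` ({0..1} \<times> {0..1}))"
  proof (rule bdd_aboveI2)
    fix x :: "real \<times> real" assume "x \<in> {0..1} \<times> {0..1}"
    then have "infnorm (x - y0) \<le> 1 + \<bar>fst y0\<bar> + \<bar>snd y0\<bar>"
      by (auto simp: infnorm_prod)
    moreover have "?f x \<le> infnorm (x - y0)"
      using assms(1) y0 by (intro Min_le) auto
    ultimately show "?f x \<le> 1 + \<bar>fst y0\<bar> + \<bar>snd y0\<bar>"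
      by linarith
  qed
  have near: "\<exists>y\<in>Q. infnorm (x - y) \<le> h" if "x \<in> {0..1} \<times> {0..1}" for x
  proof -
    have "?f x \<le> h"
      unfolding h_def covering_radius_def using that bdd by (rule cSUP_upper)
    moreover have "?f x \<in> (\<lambda>y. infnorm (x - y)) ` Q"
      using assms by (intro Min_in) auto
    ultimately show ?thesis by auto
  qed
  have "0 \<le> h"
  proof -
    have "(0, 0) \<in> {0..1 :: real} \<times> {0..1 :: real}"
      by simp
    from near[OF this] obtain y where "infnorm ((0 :: real, 0 :: real) - y) \<le> h"
      by blast
    then show ?thesis
      by (rule order_trans[OF infnorm_pos_le])
  qed
  then show "0 \<le> covering_radius Q"
    by (simp add: h_def)
  have cover: "cbox (0, 0) (1, 1) \<subseteq> (\<Union>y\<in>Q. B y)"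
  proof
    fix x :: "real \<times> real" assume "x \<in> cbox (0, 0) (1, 1)"
    then obtain y where "y \<in> Q" "infnorm (x - y) \<le> h"
      using near[of x] by (auto simp: cbox_Pair_eq)
    then show "x \<in> (\<Union>y\<in>Q. B y)"
      by (intro UN_I[of y]) (auto simp: B_def cbox_Pair_eq mem_Times_iff infnorm_prod)
  qed
  have "measure lborel (cbox (0, 0) (1, 1 :: real) :: (real \<times> real) set) = 1"
    by (simp add: content_Pair)
  then have "1 \<le> measure lborel (\<Union>y\<in>Q. B y)"
    using measure_mono_fmeasurable[OF cover, of lborel] assms(1)
    by (simp add: B_def fmeasurable.finite_UN)
  also have "\<dots> \<le> (\<Sum>y\<in>Q. measure lborel (B y))"
    using assms(1) by (intro measure_UNION_le) (simp_all add: B_def)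
  also have "\<dots> = (\<Sum>y\<in>Q. (2 * h)\<^sup>2)"
    using \<open>0 \<le> h\<close> by (intro sum.cong) (simp_all add: B_def content_Pair power2_eq_square)
  finally show "1 \<le> real (card Q) * (2 * covering_radius Q)\<^sup>2"
    by (simp add: h_def)
qed

section \<open>The bounds for the Sobol' points\<close>

lemma sobol_points_bounds:
  assumes "2 \<le> N"
  shows "separation_radius (sobol_points N) \<le> 2 powr (-3/4) * real N powr (-3/4)"
    and "mesh_ratio (sobol_points N) \<ge> 2 powr (-1/4) * real N powr (1/4)"
proof -
  let ?Q = "sobol_points N"
  define q where "q = separation_radius ?Q"
  define h where "h = covering_radius ?Q"
  have fin: "finite ?Q" "?Q \<noteq> {}" and card: "card ?Q \<le> N"
    using assms card_image_le[of "{..<N}" sobol] by (auto simp: sobol_points_def lessThan_empty_iff)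
  obtain M x y where M: "N ^ 3 \<le> 2 ^ (4 * M + 1)"
    and xy: "x \<in> ?Q" "y \<in> ?Q" "x \<noteq> y" "infnorm (x - y) \<le> 1 / 2 ^ M"
    using ex_close_pair[OF assms] unfolding has_close_pair_def by blast
  have q0: "0 < q" and "q \<le> 1 / 2 ^ Suc M"
    using separation_radius_pos[OF fin(1) xy(1-3)] separation_radius_le[OF fin(1) xy(1-3)] xy(4)
    by (simp_all add: q_def)
  have "real N ^ 3 \<le> 2 ^ (4 * M + 1)"
    using M by (metis of_nat_le_iff of_nat_numeral of_nat_power)
  \<comment> \<open>Multiplication by 8 completes the right side to a fourth power, ready for the
    fourth root.\<close>
  then have "(2 * real N) ^ 3 \<le> (2 ^ Suc M) ^ 4"
    by (simp add: power_mult_distrib power_add power_mult mult.commute[of 4] )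
  moreover have root: "(x ^ n) powr (1/4) = x powr (n / 4)" if "0 < x" for x :: real and n
    using that by (simp add: powr_powr flip: powr_realpow)
  ultimately have "((2 * real N) ^ 3) powr (1/4) \<le> ((2 ^ Suc M) ^ 4) powr (1/4)"
    by (intro powr_mono2) auto
  then have "(2 * real N) powr (3/4) \<le> 2 ^ Suc M"
    using assms root[of "2 * real N" 3] root[of "2 ^ Suc M" 4] by (simp del: power_Suc)
  then have "1 / 2 ^ Suc M \<le> 1 / (2 * real N) powr (3/4)"
    using assms by (intro divide_left_mono) auto
  with \<open>q \<le> 1 / 2 ^ Suc M\<close> have q1: "q \<le> (2 * real N) powr (-3/4)"
    by (simp add: powr_minus_divide)
  then show "separation_radius ?Q \<le> 2 powr (-3/4) * real N powr (-3/4)"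
    by (simp add: q_def powr_mult)
  have h0: "0 \<le> h"
    using card_mult_covering_radius_ge(2)[OF fin] by (simp add: h_def)
  have "1 \<le> real (card ?Q) * (2 * h)\<^sup>2"
    using card_mult_covering_radius_ge(1)[OF fin] by (simp add: h_def)
  also have "\<dots> \<le> real N * (2 * h)\<^sup>2"
    using card by (intro mult_right_mono) auto
  finally have "1 / real N \<le> (2 * h)\<^sup>2"
    using assms by (simp add: field_simps)
  then have "(1 / real N) powr (1/2) \<le> ((2 * h)\<^sup>2) powr (1/2)"
    by (intro powr_mono2) auto
  then have h1: "real N powr (-1/2) \<le> 2 * h"
    using h0 by (simp add: powr_half_sqrt powr_minus_divide real_sqrt_divide real_sqrt_mult)
  \<comment> \<open>The claimed ratio times the upper bound on \<open>q\<close> is exactly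
    \<open>N^(-1/2) / 2\<close>, the lower bound on \<open>h\<close> from the areas.\<close>
  have "2 powr (-1/4) * real N powr (1/4) * q
      \<le> 2 powr (-1/4) * real N powr (1/4) * (2 powr (-3/4) * real N powr (-3/4))"
    using q1 by (intro mult_left_mono) (simp_all add: powr_mult)
  also have "\<dots> = (2 powr (-1/4) * 2 powr (-3/4)) * (real N powr (1/4) * real N powr (-3/4))"
    by (simp only: mult_ac)
  also have "\<dots> = real N powr (-1/2) / 2"
  proof -
    have "2 powr (-1/4) * 2 powr (-3/4) = (1/2 :: real)"
      by (simp add: powr_minus_divide flip: powr_add)
    moreover have "real N powr (1/4) * real N powr (-3/4) = real N powr (-1/2)"
      by (simp flip: powr_add)
    ultimately show ?thesis by simp
  qed
  also have "\<dots> \<le> h"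
    using h1 by simp
  finally show "mesh_ratio ?Q \<ge> 2 powr (-1/4) * real N powr (1/4)"
    using q0 by (simp add: mesh_ratio_def q_def h_def pos_le_divide_eq)
qed

theorem corollary1p3:
  shows "(\<forall>N::nat. 2 \<le> N \<longrightarrow>
            separation_radius (sobol_points N) \<le> 2 powr (-1/2) * real N powr (-3/4) \<and>
            mesh_ratio (sobol_points N) \<ge> 2 powr (-1/2) * real N powr (1/4)) \<and>
         (\<forall>N::nat. 64 \<le> N \<longrightarrow>
            separation_radius (sobol_points N) \<le> 2 powr (-3/4) * real N powr (-3/4) \<and>
            mesh_ratio (sobol_points N) \<ge> 2 powr (-1/4) * real N powr (1/4))"
proof (intro conjI allI impI)
  fix N :: nat
  assume N: "2 \<le> N"
  have "2 powr (-3/4) * real N powr (-3/4) \<le> 2 powr (-1/2) * real N powr (-3/4)"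
    by (intro mult_right_mono) simp_all
  with sobol_points_bounds(1)[OF N]
  show "separation_radius (sobol_points N) \<le> 2 powr (-1/2) * real N powr (-3/4)"
    by (rule order_trans)
  have "2 powr (-1/2) * real N powr (1/4) \<le> 2 powr (-1/4) * real N powr (1/4)"
    by (intro mult_right_mono) simp_all
  then show "2 powr (-1/2) * real N powr (1/4) \<le> mesh_ratio (sobol_points N)"
    using sobol_points_bounds(2)[OF N] by (rule order_trans)
next
  fix N :: nat
  assume "64 \<le> N"
  then have "2 \<le> N" by simp
  then show "separation_radius (sobol_points N) \<le> 2 powr (-3/4) * real N powr (-3/4)"
    and "2 powr (-1/4) * real N powr (1/4) \<le> mesh_ratio (sobol_points N)"
    by (rule sobol_points_bounds)+
qed

end
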